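(* Let $\mathcal{A},\mathcal{B},\mathcal{C}$ be unital $C^*$-algebras, let $\omega:\mathcal{A}\to\mathcal{C}$ be a Schwarz-positive unital (SPU) map, and let $F,G:\mathcal{B}\to\mathcal{A}$ be linear maps. Consider the following conditions. (a) $F$ is left $\omega$-a.e. equivalent to $G$: $\omega(F(B)A)=\omega(G(B)A)$ for all $A\in\mathcal{A}$, $B\in\mathcal{B}$. (b) $F$ is right $\omega$-a.e. equivalent to $G$: $\omega(AF(B))=\omega(AG(B))$ for all $A\in\mathcal{A}$, $B\in\mathcal{B}$. (c) $F(B)-G(B)\in\mathcal{N}_\omega$ for all $B\in\mathcal{B}$. (d) (For $\mathcal{C}=\mathbb{C}$, so that $\omega$ is a state, and $\mathcal{A}$ finite-dimensional, with $P_\omega$ the support of $\omega$.) $F(B)P_\omega=G(B)P_\omega$ for all $B\in\mathcal{B}$. Then the following hold. i. (b) and (c) are equivalent. ii. If $F$ and $G$ are $*$-preserving, then (a), (b) and (c) are all equivalent. iii. If $\mathcal{C}=\mathbb{C}$, then (b), (c) and (d) are all equivalent. iv. If $\mathcal{C}=\mathbb{C}$ and $F$ and $G$ are $*$-preserving, then (a), (b), (c), (d) are all equivalent.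
   Context: A linear map $\omega:\mathcal{A}\to\mathcal{C}$ of unital $C^*$-algebras is Schwarz-positive unital (SPU) if it is unital and $\omega(A^*A)\ge\omega(A)^*\omega(A)$ for all $A$. A linear map $F$ is $*$-preserving if $F(B^* )=F(B)^*$ for all $B$. The right nullspace of $\omega$ is $\mathcal{N}_\omega:=\{A\in\mathcal{A}:\omega(A^*A)=0\}$. A state is a positive unital linear functional. If $\mathcal{A}$ is finite-dimensional and $\omega:\mathcal{A}\to\mathbb{C}$ is a state, its support $P_\omega\in\mathcal{A}$ is the unique smallest projection with $\omega(A)=\omega(P_\omega A)=\omega(AP_\omega)=\omega(P_\omega AP_\omega)$ for all $A\in\mathcal{A}$. *)

theory Defs
  imports "HOL-Analysis.Analysis"
begin

text \<open>
  Unital complex \<open>C\<^sup>*\<close>-algebras. The unit comes from \<^class>\<open>monoid_mult\<close> rather than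
  \<^class>\<open>ring_1\<close> (or \<^class>\<open>real_normed_algebra_1\<close>), so the zero algebra is not excluded.
\<close>

class unital_cstar_algebra = real_normed_algebra + monoid_mult + complete_space +
  fixes scaleC :: "complex \<Rightarrow> 'a \<Rightarrow> 'a" (infixr "*\<^sub>C" 75)
    and star :: "'a \<Rightarrow> 'a"
  assumes scaleC_add_right: "c *\<^sub>C (x + y) = c *\<^sub>C x + c *\<^sub>C y"
    and scaleC_add_left: "(c + d) *\<^sub>C x = c *\<^sub>C x + d *\<^sub>C x"
    and scaleC_scaleC: "c *\<^sub>C d *\<^sub>C x = (c * d) *\<^sub>C x"
    and scaleC_of_real: "complex_of_real r *\<^sub>C x = r *\<^sub>R x"
    and mult_scaleC_left: "(c *\<^sub>C x) * y = c *\<^sub>C (x * y)"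
    and mult_scaleC_right: "x * (c *\<^sub>C y) = c *\<^sub>C (x * y)"
    and norm_scaleC: "norm (c *\<^sub>C x) = cmod c * norm x"
    and star_star: "star (star x) = x"
    and star_add: "star (x + y) = star x + star y"
    and star_scaleC: "star (c *\<^sub>C x) = cnj c *\<^sub>C star x"
    and star_mult: "star (x * y) = star y * star x"
    and cstar_identity: "norm (star x * x) = (norm x)\<^sup>2"

lemma vector_space_scaleC:
  "vector_space (scaleC :: complex \<Rightarrow> 'a \<Rightarrow> 'a::unital_cstar_algebra)"
proof
  show "1 *\<^sub>C x = x" for x :: 'a
    using scaleC_of_real[of 1 x] by simp
qed (simp_all add: scaleC_add_right scaleC_add_left scaleC_scaleC)

instantiation complex :: unital_cstar_algebra
begin

definition scaleC_complex :: "complex \<Rightarrow> complex \<Rightarrow> complex"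
  where "scaleC_complex c z = c * z"

definition star_complex :: "complex \<Rightarrow> complex"
  where "star_complex z = cnj z"

instance
  by standard
    (auto simp: scaleC_complex_def star_complex_def algebra_simps norm_mult
      scaleR_conv_of_real power2_eq_square)

end

abbreviation clinear :: "('a::unital_cstar_algebra \<Rightarrow> 'b::unital_cstar_algebra) \<Rightarrow> bool"
  where "clinear \<equiv> Vector_Spaces.linear scaleC scaleC"

definition finite_dim :: "'a::unital_cstar_algebra itself \<Rightarrow> bool"
  where "finite_dim _ \<longleftrightarrow> (\<exists>S :: 'a set. finite S \<and> module.span scaleC S = UNIV)"

definition positive_element :: "'a::unital_cstar_algebra \<Rightarrow> bool"
  where "positive_element a \<longleftrightarrow> (\<exists>x. a = star x * x)"

definition cstar_le :: "'a::unital_cstar_algebra \<Rightarrow> 'a \<Rightarrow> bool"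
  where "cstar_le a b \<longleftrightarrow> positive_element (b - a)"

definition SPU :: "('a::unital_cstar_algebra \<Rightarrow> 'c::unital_cstar_algebra) \<Rightarrow> bool"
  where "SPU \<omega> \<longleftrightarrow> clinear \<omega> \<and> \<omega> 1 = 1 \<and>
    (\<forall>A. cstar_le (star (\<omega> A) * \<omega> A) (\<omega> (star A * A)))"

definition star_preserving :: "('b::unital_cstar_algebra \<Rightarrow> 'a::unital_cstar_algebra) \<Rightarrow> bool"
  where "star_preserving F \<longleftrightarrow> (\<forall>B. F (star B) = star (F B))"

definition right_nullspace :: "('a::unital_cstar_algebra \<Rightarrow> 'c::unital_cstar_algebra) \<Rightarrow> 'a set"
  where "right_nullspace \<omega> = {A. \<omega> (star A * A) = 0}"

definition left_ae_equivalent ::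
  "('a::unital_cstar_algebra \<Rightarrow> 'c::unital_cstar_algebra) \<Rightarrow>
    ('b::unital_cstar_algebra \<Rightarrow> 'a) \<Rightarrow> ('b \<Rightarrow> 'a) \<Rightarrow> bool"
  where "left_ae_equivalent \<omega> F G \<longleftrightarrow> (\<forall>A B. \<omega> (F B * A) = \<omega> (G B * A))"

definition right_ae_equivalent ::
  "('a::unital_cstar_algebra \<Rightarrow> 'c::unital_cstar_algebra) \<Rightarrow>
    ('b::unital_cstar_algebra \<Rightarrow> 'a) \<Rightarrow> ('b \<Rightarrow> 'a) \<Rightarrow> bool"
  where "right_ae_equivalent \<omega> F G \<longleftrightarrow> (\<forall>A B. \<omega> (A * F B) = \<omega> (A * G B))"

definition projection :: "'a::unital_cstar_algebra \<Rightarrow> bool"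
  where "projection P \<longleftrightarrow> P * P = P \<and> star P = P"

definition supports :: "('a::unital_cstar_algebra \<Rightarrow> complex) \<Rightarrow> 'a \<Rightarrow> bool"
  where "supports \<omega> P \<longleftrightarrow> projection P \<and>
    (\<forall>A. \<omega> A = \<omega> (P * A) \<and> \<omega> A = \<omega> (A * P) \<and> \<omega> A = \<omega> (P * A * P))"

text \<open>
  The smallest supporting projection. It exists and is unique when the algebra is
  finite-dimensional and \<open>\<omega>\<close> is a state; otherwise the value may be unspecified.
\<close>

definition support :: "('a::unital_cstar_algebra \<Rightarrow> complex) \<Rightarrow> 'a"
  where "support \<omega> = (THE P. supports \<omega> P \<and> (\<forall>Q. supports \<omega> Q \<longrightarrow> cstar_le P Q))"

end

theory Submission
  imports Defs
begin

text \<open>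
  Positivity of \<open>\<omega>\<close> gives the Cauchy--Schwarz type statement that \<open>\<omega> (N\<^sup>* N) = 0\<close> forces
  \<open>\<omega> (A N) = 0\<close> for all \<open>A\<close>; this is the equivalence of (b) and (c), and (a) is turned into (b) by
  taking adjoints. It rests on the elements \<open>x\<^sup>* x\<close> lying in a closed convex cone \<open>K\<close> with
  \<open>K \<inter> -K = {0}\<close>. In finite dimension the nullspace is a left ideal \<open>L\<close>. If \<open>n\<^sub>1, \<dots>, n\<^sub>k\<close> span \<open>L\<close>,
  the range projection \<open>p\<close> of \<open>\<Sum> n\<^sub>i\<^sup>* n\<^sub>i\<close> satisfies \<open>L = \<A> p\<close>, so \<open>1 - p\<close> is the support of \<open>\<omega>\<close> and
  (c) becomes (d).
\<close>

subsection \<open>Elementary rules\<close>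

lemma star_zero [simp]: "star (0::'a::unital_cstar_algebra) = 0"
  using star_add[of "0::'a" 0] by simp

lemma star_minus [simp]: "star (- x) = - star (x::'a::unital_cstar_algebra)"
  using star_add[of x "- x"] by (simp add: add_eq_0_iff)

lemma star_diff: "star (x - y) = star x - star (y::'a::unital_cstar_algebra)"
  using star_add[of x "- y"] by simp

lemma star_scaleR [simp]: "star (r *\<^sub>R x) = r *\<^sub>R star (x::'a::unital_cstar_algebra)"
  using star_scaleC[of "complex_of_real r" x] by (simp add: scaleC_of_real)

lemma star_one [simp]: "star (1::'a::unital_cstar_algebra) = 1"
  using star_mult[of "star 1 :: 'a" 1] by (simp add: star_star)

lemma star_sum: "star (sum f S) = (\<Sum>i\<in>S. star (f i :: 'a::unital_cstar_algebra))"
  by (induction S rule: infinite_finite_induct) (simp_all add: star_add)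

text \<open>The C*-identity and submultiplicativity bound the square of \<open>norm y\<close> by
  \<open>norm (star y) * norm y\<close>. Cancel, then use this for both \<open>x\<close> and
  \<open>star x\<close>.\<close>

lemma norm_star [simp]: "norm (star x) = norm (x::'a::unital_cstar_algebra)"
proof -
  have *: "norm y \<le> norm (star y)" for y :: 'a
  proof (cases "norm y = 0")
    case False
    have "norm y * norm y \<le> norm (star y) * norm y"
      using norm_mult_ineq[of "star y" y] cstar_identity[of y] by (simp add: power2_eq_square)
    then show ?thesis using False by simp
  qed simp
  show ?thesis using *[of x] *[of "star x"] by (simp add: star_star)
qed

lemma star_mult_self_eq_0 [simp]: "star x * x = 0 \<longleftrightarrow> x = (0::'a::unital_cstar_algebra)"
  using cstar_identity[of x] by auto

text \<open>Only an inequality, since the zero algebra is allowed and there \<open>1\<close> has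
  norm 0.\<close>

lemma norm_one_le: "norm (1::'a::unital_cstar_algebra) \<le> 1"
proof -
  have "norm (1::'a) * norm (1::'a) = norm (1::'a)"
    using cstar_identity[of "1::'a"] by (simp add: power2_eq_square)
  then show ?thesis by (metis mult_cancel_right1 order_refl zero_le_one)
qed

lemma norm_self_adjoint_power2:
  "star x = x \<Longrightarrow> norm (x * x) = (norm (x::'a::unital_cstar_algebra))\<^sup>2"
  using cstar_identity[of x] by simp

lemma star_power: "star (x ^ n) = star (x::'a::unital_cstar_algebra) ^ n"
  by (induction n) (simp_all add: star_mult power_commutes)

text \<open>Repeated squaring with the C*-identity. In \<open>norm_positive_swap\<close> this stands
  in for the spectral radius formula.\<close>

lemma norm_self_adjoint_power:
  assumes "star x = (x::'a::unital_cstar_algebra)"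
  shows "norm (x ^ (2 ^ k)) = norm x ^ (2 ^ k)"
proof (induction k)
  case (Suc k)
  have "x ^ (2 ^ Suc k) = x ^ (2 ^ k) * x ^ (2 ^ k)"
    by (simp add: mult_2 power_add)
  moreover have "star (x ^ (2 ^ k)) = x ^ (2 ^ k)"
    using assms by (simp add: star_power)
  ultimately show ?case
    using Suc norm_self_adjoint_power2[of "x ^ (2 ^ k)"]
    by (simp add: power_mult[symmetric] mult.commute)
qed simp

lemma scaleC_zero_left [simp]: "0 *\<^sub>C x = (0::'a::unital_cstar_algebra)"
  using scaleC_of_real[of 0 x] by simp

lemma scaleC_zero_right [simp]: "c *\<^sub>C 0 = (0::'a::unital_cstar_algebra)"
  using scaleC_add_right[of c "0::'a" 0] by simp

lemma scaleC_minus_left: "(- c) *\<^sub>C x = - (c *\<^sub>C (x::'a::unital_cstar_algebra))"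
  using scaleC_add_left[of c "- c" x] by (simp add: add_eq_0_iff)

lemma scaleC_minus_right: "c *\<^sub>C (- x) = - (c *\<^sub>C (x::'a::unital_cstar_algebra))"
  using scaleC_add_right[of c x "- x"] by (simp add: add_eq_0_iff)

lemma scaleC_diff_right: "c *\<^sub>C (x - y) = c *\<^sub>C x - c *\<^sub>C (y::'a::unital_cstar_algebra)"
  using scaleC_add_right[of c x "- y"] by (simp add: scaleC_minus_right)

lemma scaleC_one [simp]: "1 *\<^sub>C x = (x::'a::unital_cstar_algebra)"
  using scaleC_of_real[of 1 x] by simp

lemma star_mult_self_commuting:
  fixes k c :: "'a::unital_cstar_algebra"
  assumes "star k = k" "star c = c" "k * c = c * k"
  shows "star (k + \<i> *\<^sub>C c) * (k + \<i> *\<^sub>C c) = k * k + c * c"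
  using assms
  by (simp add: star_add star_scaleC distrib_left distrib_right left_diff_distrib mult_scaleC_left
      mult_scaleC_right scaleC_scaleC scaleC_minus_left scaleC_diff_right)

subsection \<open>Square roots by iteration\<close>

text \<open>
  A fixed point \<open>b = (x + b\<^sup>2) / 2\<close> satisfies \<open>(1 - b)\<^sup>2 = 1 - x\<close>. For \<open>\<parallel>x\<parallel> \<le> 1\<close> the increments of the
  iteration are dominated by those of the convergent scalar iteration at \<open>x = 1\<close>.
\<close>

primrec sqrt_iter :: "'a::real_normed_algebra \<Rightarrow> nat \<Rightarrow> 'a" where
  "sqrt_iter x 0 = 0"
| "sqrt_iter x (Suc n) = (1/2) *\<^sub>R (x + sqrt_iter x n * sqrt_iter x n)"

lemma sqrt_iter_one:
  shows "0 \<le> sqrt_iter (1::real) n" and "sqrt_iter (1::real) n \<le> 1"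
    and "sqrt_iter (1::real) n \<le> sqrt_iter 1 (Suc n)"
proof -
  show *: "0 \<le> sqrt_iter (1::real) n" for n
    by (induction n) auto
  show "sqrt_iter (1::real) n \<le> 1"
  proof (induction n)
    case (Suc n)
    then show ?case using * mult_mono[OF Suc Suc] by simp
  qed simp
  \<comment> \<open>The increment of the scalar iteration is half of this square.\<close>
  have "0 \<le> (sqrt_iter (1::real) n - 1)\<^sup>2" by simp
  then show "sqrt_iter (1::real) n \<le> sqrt_iter 1 (Suc n)"
    by (simp add: power2_eq_square algebra_simps)
qed

lemma sqrt_iter_commute:
  assumes "x * y = y * x"
  shows "sqrt_iter x n * y = y * sqrt_iter x n"
  by (induction n)
    (simp_all add: assms distrib_left distrib_right, metis mult.assoc)

lemma sqrt_iter_commute_iter: "sqrt_iter x n * sqrt_iter x m = sqrt_iter x m * sqrt_iter x n"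
  by (metis sqrt_iter_commute)

lemma star_sqrt_iter:
  "star x = x \<Longrightarrow> star (sqrt_iter x n) = sqrt_iter (x::'a::unital_cstar_algebra) n"
  by (induction n) (simp_all add: star_add star_mult)

lemma norm_sqrt_iter:
  fixes x :: "'a::real_normed_algebra"
  assumes "norm x \<le> 1"
  shows "norm (sqrt_iter x n) \<le> sqrt_iter 1 n"
proof (induction n)
  case (Suc n)
  have "norm (x + sqrt_iter x n * sqrt_iter x n) \<le> norm x + norm (sqrt_iter x n) * norm (sqrt_iter x n)"
    by (meson add_left_mono norm_mult_ineq norm_triangle_ineq order_trans)
  also have "\<dots> \<le> 1 + sqrt_iter 1 n * sqrt_iter 1 n"
    using assms Suc by (intro add_mono mult_mono) (auto simp: sqrt_iter_one)
  finally show ?case by simp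
qed simp

text \<open>Iterates commute, so a difference of their squares factors; both factors are bounded by
  their scalar counterparts.\<close>

lemma norm_sqrt_iter_step:
  fixes x :: "'a::real_normed_algebra"
  assumes "norm x \<le> 1"
  shows "norm (sqrt_iter x (Suc n) - sqrt_iter x n) \<le> sqrt_iter 1 (Suc n) - sqrt_iter 1 n"
proof (induction n)
  case 0
  then show ?case using assms by simp
next
  case (Suc n)
  let ?b = "sqrt_iter x" and ?r = "sqrt_iter (1::real)"
  have "?b (Suc (Suc n)) - ?b (Suc n)
      = (1/2) *\<^sub>R (x + ?b (Suc n) * ?b (Suc n)) - (1/2) *\<^sub>R (x + ?b n * ?b n)"
    by (metis sqrt_iter.simps(2))
  also have "\<dots> = (1/2) *\<^sub>R (?b (Suc n) * ?b (Suc n) - ?b n * ?b n)"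
    by (simp add: scaleR_diff_right[symmetric] del: sqrt_iter.simps)
  also have "\<dots> = (1/2) *\<^sub>R ((?b (Suc n) - ?b n) * (?b (Suc n) + ?b n))"
    using sqrt_iter_commute_iter[of x "Suc n" n]
    by (simp add: distrib_left left_diff_distrib del: sqrt_iter.simps)
  finally have "norm (?b (Suc (Suc n)) - ?b (Suc n))
      \<le> (1/2) * (norm (?b (Suc n) - ?b n) * norm (?b (Suc n) + ?b n))"
    by (simp add: norm_mult_ineq del: sqrt_iter.simps)
  also have "\<dots> \<le> (1/2) * ((?r (Suc n) - ?r n) * (?r (Suc n) + ?r n))"
  proof -
    have "norm (?b (Suc n) + ?b n) \<le> ?r (Suc n) + ?r n"
      using norm_sqrt_iter[OF assms, of n] norm_sqrt_iter[OF assms, of "Suc n"]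
      by (meson add_mono norm_triangle_ineq order_trans)
    then show ?thesis
      using Suc sqrt_iter_one(3)[of n]
      by (intro mult_left_mono mult_mono) (auto simp del: sqrt_iter.simps)
  qed
  also have "\<dots> = ?r (Suc (Suc n)) - ?r (Suc n)"
    by (simp add: field_simps)
  finally show ?case .
qed

lemma convergent_sqrt_iter:
  fixes x :: "'a::{real_normed_algebra,complete_space}"
  assumes "norm x \<le> 1"
  shows "convergent (sqrt_iter x)"
proof -
  let ?b = "sqrt_iter x" and ?r = "sqrt_iter (1::real)"
  have step: "norm (?b (m + k) - ?b m) \<le> ?r (m + k) - ?r m" for m k
  proof (induction k)
    case (Suc k)
    have "norm (?b (m + Suc k) - ?b m)
        \<le> norm (?b (Suc (m + k)) - ?b (m + k)) + norm (?b (m + k) - ?b m)"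
      using norm_triangle_ineq[of "?b (Suc (m + k)) - ?b (m + k)" "?b (m + k) - ?b m"]
      by (simp del: sqrt_iter.simps)
    then show ?case
      using Suc norm_sqrt_iter_step[OF assms, of "m + k"] by (simp del: sqrt_iter.simps)
  qed simp
  have "incseq ?r"
    using sqrt_iter_one(3) by (intro incseq_SucI) blast
  then have "convergent ?r"
    using sqrt_iter_one(2) by (metis incseq_convergent convergentI)
  then have "Cauchy ?r" by (simp add: convergent_Cauchy)
  have "Cauchy ?b"
  proof (rule CauchyI')
    fix e :: real
    assume "0 < e"
    then obtain M where M: "\<And>m n. m \<ge> M \<Longrightarrow> n \<ge> M \<Longrightarrow> norm (?r m - ?r n) < e"
      using CauchyD[OF \<open>Cauchy ?r\<close>] by blast
    have "dist (?b m) (?b n) < e" if "m \<ge> M" "n > m" for m n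
      using step[of m "n - m"] M[of n m] that
      by (auto simp: dist_norm norm_minus_commute)
    then show "\<exists>M. \<forall>m\<ge>M. \<forall>n>m. dist (?b m) (?b n) < e" by blast
  qed
  then show ?thesis by (simp add: Cauchy_convergent)
qed

lemma tendsto_star:
  assumes "f \<longlonglongrightarrow> (l::'a::unital_cstar_algebra)"
  shows "(\<lambda>n. star (f n)) \<longlonglongrightarrow> star l"
proof -
  have "(\<lambda>n. norm (f n - l)) \<longlonglongrightarrow> 0"
    using assms by (simp add: LIM_zero tendsto_norm_zero)
  moreover have "norm (f n - l) = norm (star (f n) - star l)" for n
    by (metis norm_star star_diff)
  ultimately have "(\<lambda>n. star (f n) - star l) \<longlonglongrightarrow> 0"
    by (simp add: tendsto_norm_zero_iff)
  then show ?thesis by (rule LIM_zero_cancel)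
qed

text \<open>All properties of the iterates pass to the limit \<open>b\<close>. The commutation
  clause takes the place of functional calculus: it lets square roots of commuting elements
  commute.\<close>

lemma sqrt_one_minus:
  fixes x :: "'a::unital_cstar_algebra"
  assumes "star x = x" "norm x \<le> 1"
  obtains b where "star b = b" "norm b \<le> 1" "(1 - b) * (1 - b) = 1 - x"
    "\<And>y. x * y = y * x \<Longrightarrow> b * y = y * b"
proof -
  obtain b where b: "sqrt_iter x \<longlonglongrightarrow> b"
    using convergent_sqrt_iter[OF assms(2)] by (auto simp: convergent_def)
  have 1: "star b = b"
    using tendsto_star[OF b] b by (simp add: star_sqrt_iter assms(1) LIMSEQ_unique)
  have 2: "norm b \<le> 1"
    using tendsto_norm[OF b] norm_sqrt_iter[OF assms(2)] sqrt_iter_one(2)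
    by (meson LIMSEQ_le_const2 order_trans)
  have "(\<lambda>n. sqrt_iter x (Suc n)) \<longlonglongrightarrow> (1/2) *\<^sub>R (x + b * b)"
    unfolding sqrt_iter.simps by (intro tendsto_intros b)
  then have "b = (1/2) *\<^sub>R (x + b * b)"
    using LIMSEQ_Suc[OF b] LIMSEQ_unique by blast
  from arg_cong[OF this, of "\<lambda>z. 2 *\<^sub>R z"] have "b + b = x + b * b"
    by (simp add: scaleR_2)
  moreover have "(1 - b) * (1 - b) = 1 - (b + b) + b * b"
    by (simp add: algebra_simps)
  ultimately have 3: "(1 - b) * (1 - b) = 1 - x" by simp
  have 4: "b * y = y * b" if "x * y = y * x" for y
  proof -
    have "(\<lambda>n. sqrt_iter x n * y) \<longlonglongrightarrow> b * y" "(\<lambda>n. y * sqrt_iter x n) \<longlonglongrightarrow> y * b"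
      by (intro tendsto_intros b)+
    then show ?thesis
      using sqrt_iter_commute[OF that] by (simp add: LIMSEQ_unique)
  qed
  show ?thesis by (rule that[OF 1 2 3 4])
qed

text \<open>For \<open>s = 1\<close>: \<open>c = \<surd>(1 - h\<^sup>2)\<close> is a contraction because \<open>h + \<i> c\<close> is an isometry.\<close>

lemma norm_diff_square_le:
  fixes h :: "'a::unital_cstar_algebra"
  assumes h: "star h = h" and s: "norm (h * h) \<le> s"
  shows "norm (s *\<^sub>R 1 - h * h) \<le> s"
proof (cases "s = 0")
  case True
  then show ?thesis using s by simp
next
  case False
  have "s > 0" using s False norm_ge_zero[of "h * h"] by linarith
  define k where "k = (1 / sqrt s) *\<^sub>R h"
  have k: "star k = k" by (simp add: k_def h)
  have kk: "k * k = (1 / s) *\<^sub>R (h * h)"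
    using \<open>s > 0\<close> by (simp add: k_def)
  have "norm (k * k) \<le> 1"
    using s \<open>s > 0\<close> by (simp add: kk field_simps)
  moreover have "star (k * k) = k * k" by (simp add: star_mult k)
  ultimately obtain b where b: "star b = b" "(1 - b) * (1 - b) = 1 - k * k"
    "\<And>y. k * k * y = y * (k * k) \<Longrightarrow> b * y = y * b"
    using sqrt_one_minus by metis
  define c where "c = 1 - b"
  have c: "star c = c" "c * c = 1 - k * k" "k * c = c * k"
    using b(1,2) b(3)[of k] by (simp_all add: c_def star_diff algebra_simps)
  let ?u = "k + \<i> *\<^sub>C c"
  have "star ?u * ?u = 1"
    using star_mult_self_commuting[OF k c(1,3)] c(2) by simp
  then have "(norm ?u)\<^sup>2 \<le> 1"
    using cstar_identity[of ?u] norm_one_le by metis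
  then have u: "norm ?u \<le> 1" by (simp add: abs_square_le_1)
  \<comment> \<open>\<open>c\<close> is the imaginary part of \<open>?u\<close>, so its norm is at
    most that of \<open>?u\<close>.\<close>
  have "?u - star ?u = 2 *\<^sub>R (\<i> *\<^sub>C c)"
    by (simp add: star_add star_scaleC k c(1) scaleC_minus_left scaleR_2)
  then have "2 * norm c = norm (?u - star ?u)" by (simp add: norm_scaleC)
  also have "\<dots> \<le> norm ?u + norm (star ?u)" by (rule norm_triangle_ineq4)
  finally have "norm c \<le> 1" using u by simp
  then have "norm (1 - k * k) \<le> 1"
    using norm_self_adjoint_power2[OF c(1)] c(2) by (simp add: power_le_one)
  moreover have "s *\<^sub>R 1 - h * h = s *\<^sub>R (1 - k * k)"
    using \<open>s > 0\<close> by (simp add: kk scaleR_diff_right)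
  ultimately show ?thesis using \<open>s > 0\<close> by simp
qed

subsection \<open>The positive cone\<close>

text \<open>
  For self-adjoint \<open>a\<close> the norm condition says that the spectrum lies in \<open>[0, 2 t]\<close>. In this form
  closure under addition is immediate and no spectral theory is needed.
\<close>

definition norm_positive :: "'a::unital_cstar_algebra \<Rightarrow> bool"
  where "norm_positive a \<longleftrightarrow> star a = a \<and> (\<exists>t\<ge>0. norm (t *\<^sub>R 1 - a) \<le> t)"

lemma norm_positive_self_adjoint: "norm_positive a \<Longrightarrow> star a = a"
  by (simp add: norm_positive_def)

lemma norm_positive_square:
  "star h = h \<Longrightarrow> norm_positive (h * (h::'a::unital_cstar_algebra))"
  unfolding norm_positive_def
  using norm_diff_square_le[of h "norm (h * h)"]
  by (auto simp: star_mult intro!: exI[of _ "norm (h * h)"])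

lemma norm_positive_add:
  assumes "norm_positive a" "norm_positive b"
  shows "norm_positive (a + b)"
proof -
  obtain s t where st: "0 \<le> s" "norm (s *\<^sub>R 1 - a) \<le> s" "0 \<le> t" "norm (t *\<^sub>R 1 - b) \<le> t"
    using assms by (auto simp: norm_positive_def)
  have "(s + t) *\<^sub>R 1 - (a + b) = (s *\<^sub>R 1 - a) + (t *\<^sub>R 1 - b)"
    by (simp add: scaleR_add_left)
  then have "norm ((s + t) *\<^sub>R 1 - (a + b)) \<le> s + t"
    using st(2,4) by (simp only: norm_triangle_mono)
  then show ?thesis
    using st assms unfolding norm_positive_def by (metis add_nonneg_nonneg star_add)
qed

lemma norm_positive_scaleR:
  assumes "norm_positive a" "0 \<le> r"
  shows "norm_positive (r *\<^sub>R a)"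
proof -
  obtain t where t: "0 \<le> t" "norm (t *\<^sub>R 1 - a) \<le> t"
    using assms by (auto simp: norm_positive_def)
  have "norm ((r * t) *\<^sub>R 1 - r *\<^sub>R a) = r * norm (t *\<^sub>R 1 - a)"
    using assms(2) by (simp flip: scaleR_scaleR scaleR_diff_right)
  also have "\<dots> \<le> r * t" using t assms by (simp add: mult_left_mono)
  finally show ?thesis
    using t assms unfolding norm_positive_def by (metis mult_nonneg_nonneg star_scaleR)
qed

text \<open>After rescaling, \<open>x = 1 - a / t\<close> is a contraction, and \<open>1 - b\<close>
  from \<open>sqrt_one_minus\<close> squares to \<open>a / t\<close>. It is positive with witness 1,
  because \<open>b\<close> is a contraction.\<close>

lemma norm_positive_sqrt:
  fixes a :: "'a::unital_cstar_algebra"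
  assumes "norm_positive a"
  obtains c where "norm_positive c" "c * c = a" "\<forall>y. a * y = y * a \<longrightarrow> c * y = y * c"
proof -
  obtain t where t: "0 \<le> t" "norm (t *\<^sub>R 1 - a) \<le> t" and a: "star a = a"
    using assms by (auto simp: norm_positive_def)
  show ?thesis
  proof (cases "t = 0")
    case True
    then have "a = 0" using t by simp
    moreover have "norm_positive (0::'a)"
      using norm_positive_square[of "0::'a"] by simp
    ultimately show ?thesis using that[of 0] by simp
  next
    case False
    then have "t > 0" using t by simp
    define x where "x = 1 - (1 / t) *\<^sub>R a"
    have "x = (1 / t) *\<^sub>R (t *\<^sub>R 1 - a)"
      using \<open>t > 0\<close> by (simp add: x_def scaleR_diff_right)
    then have "norm x \<le> 1" using t \<open>t > 0\<close> by simp
    moreover have "star x = x" by (simp add: x_def star_diff a)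
    ultimately obtain b where b: "star b = b" "norm b \<le> 1" "(1 - b) * (1 - b) = 1 - x"
      "\<And>y. x * y = y * x \<Longrightarrow> b * y = y * b"
      using sqrt_one_minus by metis
    have "norm_positive (1 - b)"
      unfolding norm_positive_def using b by (auto simp: star_diff intro!: exI[of _ 1])
    then have "norm_positive (sqrt t *\<^sub>R (1 - b))"
      using t by (simp add: norm_positive_scaleR)
    moreover have "sqrt t *\<^sub>R (1 - b) * sqrt t *\<^sub>R (1 - b) = a"
      using b(3) \<open>t > 0\<close> by (simp add: x_def)
    moreover have "sqrt t *\<^sub>R (1 - b) * y = y * sqrt t *\<^sub>R (1 - b)" if "a * y = y * a" for y
      using b(4)[of y] that by (simp add: x_def algebra_simps)
    ultimately show ?thesis using that by blast
  qed
qed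

text \<open>Commuting square roots \<open>c\<close> of \<open>a\<close> and \<open>d\<close> of
  \<open>- a\<close> make \<open>c + \<i> *\<^sub>C d\<close> satisfy
  \<open>star ?u * ?u = a - a = 0\<close>, so its real part \<open>c\<close> vanishes.\<close>

lemma norm_positive_antisym:
  fixes a :: "'a::unital_cstar_algebra"
  assumes "norm_positive a" "norm_positive (- a)"
  shows "a = 0"
proof -
  obtain c where c: "norm_positive c" "c * c = a"
    by (rule norm_positive_sqrt[OF assms(1)])
  obtain d where d: "norm_positive d" "d * d = - a"
    "\<forall>y. - a * y = y * - a \<longrightarrow> d * y = y * d"
    by (rule norm_positive_sqrt[OF assms(2)])
  have sa: "star c = c" "star d = d"
    using c(1) d(1) by (simp_all add: norm_positive_self_adjoint)
  have "a * c = c * a" using c(2) by (metis mult.assoc)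
  then have "- a * c = c * - a" by simp
  then have "c * d = d * c" using d(3) by metis
  let ?u = "c + \<i> *\<^sub>C d"
  have "star ?u * ?u = 0"
    using star_mult_self_commuting[OF sa \<open>c * d = d * c\<close>] c(2) d(2) by simp
  then have "?u = 0" by simp
  moreover have "star ?u = 0" using \<open>?u = 0\<close> star_zero by metis
  ultimately have "?u + star ?u = 0" by simp
  moreover have "?u + star ?u = 2 *\<^sub>R c"
    by (simp add: star_add star_scaleC sa scaleC_minus_left scaleR_2)
  ultimately show ?thesis using c(2) by simp
qed

text \<open>The definition supplies some radius; writing \<open>a\<close> as a square makes every
  \<open>s\<close> above its norm admissible.\<close>

lemma norm_positive_norm_bound:
  fixes a :: "'a::unital_cstar_algebra"
  assumes "norm_positive a" "norm a \<le> s"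
  shows "norm (s *\<^sub>R 1 - a) \<le> s"
proof -
  obtain c where "norm_positive c" "c * c = a"
    by (rule norm_positive_sqrt[OF assms(1)])
  then show ?thesis
    using norm_diff_square_le[of c s] assms(2) by (simp add: norm_positive_self_adjoint)
qed

text \<open>
  With \<open>c = t - y\<^sup>* y\<close> and \<open>d = t - y y\<^sup>*\<close> one has \<open>c y\<^sup>* = y\<^sup>* d\<close>, hence
  \<open>c\<^sup>n = t\<^sup>n - y\<^sup>* q\<^sub>n y\<close> where \<open>q\<^sub>n\<close> has norm at most \<open>n t\<^sup>n\<^sup>-\<^sup>1\<close>. So \<open>\<parallel>c\<^sup>n\<parallel>\<close> exceeds \<open>t\<^sup>n\<close> only by
  a factor linear in \<open>n\<close>, while \<open>\<parallel>c\<^sup>n\<parallel> = \<parallel>c\<parallel>\<^sup>n\<close> for infinitely many \<open>n\<close>.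
\<close>

lemma norm_positive_swap:
  fixes y :: "'a::unital_cstar_algebra"
  assumes "norm_positive (y * star y)"
  shows "norm_positive (star y * y)"
proof -
  define t where "t = norm (y * star y) + 1"
  have "t > 0" unfolding t_def by (smt (verit) norm_ge_zero)
  define c d where "c = t *\<^sub>R 1 - star y * y" and "d = t *\<^sub>R 1 - y * star y"
  have d: "norm d \<le> t"
    unfolding d_def using norm_positive_norm_bound[OF assms] by (simp add: t_def)
  have cy: "c * star y = star y * d"
    by (simp add: c_def d_def algebra_simps)
  have c: "star c = c"
    by (simp add: c_def star_diff star_mult star_star)
  \<comment> \<open>The recursion is \<open>q' = t ^ n *\<^sub>R 1 + d * q\<close>, starting from 0.
    Bounding \<open>t * norm q\<close> avoids the exponent \<open>n - 1\<close>.\<close>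
  have pow: "\<exists>q. c ^ n = t ^ n *\<^sub>R 1 - star y * q * y \<and> t * norm q \<le> real n * t ^ n" for n
  proof (induction n)
    case 0
    show ?case by (rule exI[of _ 0]) simp
  next
    case (Suc n)
    then obtain q where q: "c ^ n = t ^ n *\<^sub>R 1 - star y * q * y" "t * norm q \<le> real n * t ^ n"
      by blast
    have "c ^ Suc n = t ^ n *\<^sub>R c - (c * star y) * q * y"
      using q(1) by (simp add: right_diff_distrib mult.assoc)
    also have "\<dots> = t ^ n *\<^sub>R c - star y * (d * q) * y"
      by (simp add: cy mult.assoc)
    also have "\<dots> = t ^ Suc n *\<^sub>R 1 - star y * (t ^ n *\<^sub>R 1 + d * q) * y"
      by (simp add: c_def algebra_simps)
    finally have 1: "c ^ Suc n = t ^ Suc n *\<^sub>R 1 - star y * (t ^ n *\<^sub>R 1 + d * q) * y" .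
    have "norm (t ^ n *\<^sub>R (1::'a)) \<le> t ^ n"
      using norm_one_le[where 'a='a] \<open>t > 0\<close> by simp
    moreover have "norm (d * q) \<le> t * norm q"
      using norm_mult_ineq[of d q] mult_right_mono[OF d, of "norm q"] by simp
    ultimately have "norm (t ^ n *\<^sub>R 1 + d * q) \<le> t ^ n + real n * t ^ n"
      using norm_triangle_ineq[of "t ^ n *\<^sub>R (1::'a)" "d * q"] q(2) by linarith
    then have "t * norm (t ^ n *\<^sub>R 1 + d * q) \<le> t * (t ^ n + real n * t ^ n)"
      using \<open>t > 0\<close> by (simp add: mult_left_mono)
    also have "\<dots> = real (Suc n) * t ^ Suc n" by (simp add: algebra_simps)
    finally show ?case using 1 by blast
  qed
  define K where "K = (norm y)\<^sup>2 / t"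
  have bound: "norm (c ^ n) \<le> (1 + real n * K) * t ^ n" for n
  proof -
    obtain q where q: "c ^ n = t ^ n *\<^sub>R 1 - star y * q * y" "t * norm q \<le> real n * t ^ n"
      using pow by blast
    have "norm (t ^ n *\<^sub>R (1::'a)) \<le> t ^ n"
      using norm_one_le[where 'a='a] \<open>t > 0\<close> by simp
    moreover have "norm (star y * q * y) \<le> norm (star y) * norm q * norm y"
      by (meson mult_right_mono norm_ge_zero norm_mult_ineq order_trans)
    moreover have "norm (star y) * norm q * norm y = K * (t * norm q)"
      using \<open>t > 0\<close> by (simp add: K_def power2_eq_square)
    moreover have "K * (t * norm q) \<le> K * (real n * t ^ n)"
      using q(2) \<open>t > 0\<close> by (intro mult_left_mono) (auto simp: K_def)
    ultimately have "norm (c ^ n) \<le> t ^ n + K * (real n * t ^ n)"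
      unfolding q(1) using norm_triangle_ineq4[of "t ^ n *\<^sub>R 1" "star y * q * y"] by linarith
    then show ?thesis by (simp add: algebra_simps)
  qed
  have "norm c \<le> t"
  proof (rule ccontr)
    assume "\<not> norm c \<le> t"
    define r where "r = norm c / t"
    have "r > 1" using \<open>\<not> norm c \<le> t\<close> \<open>t > 0\<close> by (simp add: r_def)
    have le: "r ^ (2 ^ k) \<le> 1 + real (2 ^ k) * K" for k
      using bound[of "2 ^ k"] \<open>t > 0\<close>
      by (simp add: norm_self_adjoint_power[OF c] r_def power_divide pos_divide_le_eq)
    have "(\<lambda>n. (1 + real n * K) / r ^ n) \<longlonglongrightarrow> 0"
    proof -
      have "(\<lambda>n. real n / r ^ n) \<longlonglongrightarrow> 0"
        using \<open>r > 1\<close> lim_n_over_pown[of r] by simp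
      moreover have "(\<lambda>n. 1 / r ^ n) \<longlonglongrightarrow> 0"
        using LIMSEQ_inverse_realpow_zero[OF \<open>r > 1\<close>] by (simp add: inverse_eq_divide)
      ultimately have "(\<lambda>n. 1 / r ^ n + K * (real n / r ^ n)) \<longlonglongrightarrow> 0 + K * 0"
        by (intro tendsto_intros)
      then show ?thesis by (simp add: add_divide_distrib mult.commute)
    qed
    then have "\<forall>\<^sub>F n in sequentially. (1 + real n * K) / r ^ n < 1"
      by (simp add: order_tendstoD(2))
    then obtain N where N: "\<And>n. n \<ge> N \<Longrightarrow> (1 + real n * K) / r ^ n < 1"
      by (auto simp: eventually_sequentially)
    \<comment> \<open>The lower bound for the growth is exact only at powers of two, so the large
      exponent is chosen among them.\<close>
    have "N \<le> 2 ^ N" using less_exp[of N] by simp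
    then have "1 + real (2 ^ N) * K < r ^ (2 ^ N)"
      using N[of "2 ^ N"] \<open>r > 1\<close> by (simp add: pos_divide_less_eq)
    then show False using le[of N] by simp
  qed
  then show ?thesis
    unfolding norm_positive_def c_def using \<open>t > 0\<close>
    by (auto simp: star_mult star_star intro!: exI[of _ t])
qed

lemma cartesian_decomposition:
  fixes y :: "'a::unital_cstar_algebra"
  obtains a b where "star a = a" "star b = b" "y = a + \<i> *\<^sub>C b" "star y = a - \<i> *\<^sub>C b"
proof -
  define a b where "a = (1/2) *\<^sub>R (y + star y)" and "b = \<i> *\<^sub>C ((1/2) *\<^sub>R (star y - y))"
  have a: "star a = a" by (simp add: a_def star_add star_star add.commute)
  have b: "star b = b"
    by (simp add: b_def star_scaleC star_diff star_star scaleC_minus_left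
        flip: scaleC_minus_right scaleR_minus_right)
  have "\<i> *\<^sub>C b = (1/2) *\<^sub>R (y - star y)"
    by (simp add: b_def scaleC_scaleC scaleC_minus_left flip: scaleR_minus_right)
  then have y: "y = a + \<i> *\<^sub>C b"
    by (simp add: a_def flip: scaleR_add_right scaleR_2)
  have "star y = a - \<i> *\<^sub>C b"
    by (simp add: y star_add star_scaleC a b scaleC_minus_left)
  with a b y show ?thesis by (rule that)
qed

text \<open>
  Put \<open>h = x\<^sup>* x\<close> and \<open>g = \<bar>h\<bar>\<close>. For \<open>y = x (g - h)\<close> the element \<open>- y\<^sup>* y = g (g - h)\<^sup>2\<close> is positive, and
  since \<open>y\<^sup>* y + y y\<^sup>*\<close> is positive, so is \<open>y y\<^sup>*\<close>; swapping the factors forces \<open>y = 0\<close>.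
\<close>

lemma norm_positive_star_mult_self: "norm_positive (star x * (x::'a::unital_cstar_algebra))"
proof -
  define h where "h = star x * x"
  have h: "star h = h" by (simp add: h_def star_mult star_star)
  obtain g where g: "norm_positive g" "g * g = h * h"
    "\<forall>y. h * h * y = y * (h * h) \<longrightarrow> g * y = y * g"
    by (rule norm_positive_sqrt[OF norm_positive_square[OF h]])
  have gh: "g * h = h * g" using g(3) by (metis mult.assoc)
  \<comment> \<open>A root of \<open>g\<close> exhibits \<open>m * g * m\<close> as the square of
    the self-adjoint \<open>r * m\<close>.\<close>
  obtain r where r: "norm_positive r" "r * r = g" "\<forall>y. g * y = y * g \<longrightarrow> r * y = y * r"
    by (rule norm_positive_sqrt[OF g(1)])
  define m where "m = g - h"
  have m: "star m = m"
    using h g(1) by (simp add: m_def star_diff norm_positive_self_adjoint)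
  have rm: "r * m = m * r"
    by (rule r(3)[rule_format]) (simp add: m_def algebra_simps gh)
  define y where "y = x * m"
  \<comment> \<open>Since \<open>g\<close> and \<open>h\<close> commute and have equal squares,
    \<open>(g + h) * (g - h) = 0\<close>.\<close>
  have "h * m = - (g * m)"
    by (simp add: m_def right_diff_distrib g(2) gh)
  have "star y * y = m * (h * m)"
    by (simp add: y_def star_mult m h_def mult.assoc)
  also have "\<dots> = - (m * (r * r * m))"
    using \<open>h * m = - (g * m)\<close> r(2) by simp
  also have "\<dots> = - ((r * m) * (r * m))"
    by (metis rm mult.assoc)
  finally have yy: "star y * y = - ((r * m) * (r * m))" .
  have "star (r * m) = r * m"
    using r(1) rm m by (simp add: star_mult norm_positive_self_adjoint)
  then have neg: "norm_positive (- (star y * y))"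
    using yy norm_positive_square[of "r * m"] by simp
  obtain a b where ab: "star a = a" "star b = b"
    and y_ab: "y = a + \<i> *\<^sub>C b" "star y = a - \<i> *\<^sub>C b"
    by (rule cartesian_decomposition)
  have sum: "star y * y + y * star y = 2 *\<^sub>R (a * a + b * b)"
    unfolding y_ab(2) unfolding y_ab(1)
    by (simp add: distrib_left distrib_right left_diff_distrib right_diff_distrib
        mult_scaleC_left mult_scaleC_right scaleC_scaleC scaleC_minus_left scaleC_add_right
        scaleC_diff_right scaleR_2)
  have "norm_positive (2 *\<^sub>R (a * a + b * b))"
    using ab by (intro norm_positive_scaleR norm_positive_add norm_positive_square) auto
  then have "norm_positive (2 *\<^sub>R (a * a + b * b) + - (star y * y))"
    using neg by (rule norm_positive_add)
  moreover have "2 *\<^sub>R (a * a + b * b) + - (star y * y) = y * star y"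
    using sum by (metis add.commute add_diff_cancel_left' uminus_add_conv_diff)
  ultimately have "norm_positive (y * star y)" by simp
  then have "star y * y = 0"
    using norm_positive_swap neg norm_positive_antisym by blast
  then have "x * m = 0" by (simp add: y_def)
  then have "h * m = 0" by (simp add: h_def mult.assoc)
  then have "g * m = 0" using \<open>h * m = - (g * m)\<close> by simp
  then have "m * m = 0"
    using \<open>h * m = 0\<close> by (metis m_def diff_self left_diff_distrib)
  then have "m = 0" using star_mult_self_eq_0[of m] m by simp
  then show ?thesis using g(1) by (simp add: m_def h_def)
qed

text \<open>One radius \<open>s\<close> serves all \<open>t = 1 / (n + 1)\<close>, so the norm bound
  survives the limit.\<close>

lemma norm_positive_limit:
  fixes H K :: "'a::unital_cstar_algebra"
  assumes "\<And>t. 0 < t \<Longrightarrow> norm_positive (H + t *\<^sub>R K)" and H: "star H = H"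
  shows "norm_positive H"
proof -
  define s where "s = norm H + norm K"
  have "0 \<le> s" by (simp add: s_def)
  have b: "norm (s *\<^sub>R 1 - (H + (1 / real (Suc n)) *\<^sub>R K)) \<le> s" for n
  proof (rule norm_positive_norm_bound)
    have "norm ((1 / real (Suc n)) *\<^sub>R K) \<le> norm K"
      by (simp add: divide_le_eq mult_right_le_one_le algebra_simps)
    then show "norm (H + (1 / real (Suc n)) *\<^sub>R K) \<le> s"
      unfolding s_def by (meson add_left_mono norm_triangle_ineq order_trans)
  qed (use assms in simp)
  have "(\<lambda>n. norm (s *\<^sub>R 1 - (H + (1 / real (Suc n)) *\<^sub>R K)))
      \<longlonglongrightarrow> norm (s *\<^sub>R 1 - (H + 0 *\<^sub>R K))"
    by (intro tendsto_intros LIMSEQ_Suc[OF lim_1_over_n])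
  then have "norm (s *\<^sub>R 1 - H) \<le> s"
    using LIMSEQ_le_const2[of _ _ s] b by fastforce
  then show ?thesis
    unfolding norm_positive_def using H \<open>0 \<le> s\<close> by blast
qed

subsection \<open>Schwarz-positive unital maps\<close>

lemma clinear_add: "clinear f \<Longrightarrow> f (x + y) = f x + f y"
  and clinear_scaleC: "clinear f \<Longrightarrow> f (c *\<^sub>C x) = c *\<^sub>C f x"
  by (simp_all add: Vector_Spaces.linear_iff)

lemma clinear_scaleR: "clinear f \<Longrightarrow> f (r *\<^sub>R x) = r *\<^sub>R f x"
  by (metis clinear_scaleC scaleC_of_real)

lemma clinear_diff: "clinear f \<Longrightarrow> f (x - y) = f x - f y"
  by (metis add_diff_cancel clinear_add diff_add_cancel)

lemma clinear_zero: "clinear f \<Longrightarrow> f 0 = 0"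
  by (metis clinear_diff diff_self)

text \<open>Makes the least supporting projection unique, as \<open>THE\<close> in
  \<open>support\<close> demands.\<close>

lemma cstar_le_antisym:
  assumes "cstar_le a b" "cstar_le b a"
  shows "a = b"
proof -
  obtain x y where "b - a = star x * x" "a - b = star y * y"
    using assms by (auto simp: cstar_le_def positive_element_def)
  then have "norm_positive (b - a)" "norm_positive (- (b - a))"
    using norm_positive_star_mult_self by (metis, metis minus_diff_eq)
  then have "b - a = 0" by (rule norm_positive_antisym)
  then show ?thesis by simp
qed

lemma SPU_norm_positive:
  assumes "SPU \<omega>"
  shows "norm_positive (\<omega> (star A * A))"
proof -
  obtain x where "\<omega> (star A * A) - star (\<omega> A) * \<omega> A = star x * x"
    using assms by (auto simp: SPU_def cstar_le_def positive_element_def)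
  then have "\<omega> (star A * A) = star x * x + star (\<omega> A) * \<omega> A"
    by (simp add: diff_eq_eq)
  then show ?thesis
    by (simp add: norm_positive_add norm_positive_star_mult_self)
qed

text \<open>Polarization writes a self-adjoint \<open>h\<close> as a quarter of the difference of
  the squares of \<open>h + 1\<close> and \<open>h - 1\<close>, whose images are self-adjoint. The
  general case follows by Cartesian decomposition.\<close>

lemma SPU_star:
  assumes "SPU \<omega>"
  shows "\<omega> (star A) = star (\<omega> A)"
proof -
  have lin: "clinear \<omega>" using assms by (simp add: SPU_def)
  have sa: "star (\<omega> h) = \<omega> h" if "star h = h" for h
  proof -
    have "(h + 1) * (h + 1) - (h - 1) * (h - 1) = 4 *\<^sub>R h"
      using scaleR_add_left[of 2 2 h] by (simp add: algebra_simps scaleR_2)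
    then have "h = (1/4) *\<^sub>R (star (h + 1) * (h + 1) - star (h - 1) * (h - 1))"
      by (simp add: that star_add star_diff)
    then have "\<omega> h = (1/4) *\<^sub>R (\<omega> (star (h + 1) * (h + 1)) - \<omega> (star (h - 1) * (h - 1)))"
      by (metis lin clinear_scaleR clinear_diff)
    then show ?thesis
      by (metis SPU_norm_positive[OF assms] norm_positive_self_adjoint star_diff star_scaleR)
  qed
  obtain a b where ab: "star a = a" "star b = b"
    and A: "A = a + \<i> *\<^sub>C b" "star A = a - \<i> *\<^sub>C b"
    by (rule cartesian_decomposition)
  show ?thesis
    unfolding A(2) unfolding A(1)
    by (simp add: lin clinear_diff clinear_add clinear_scaleC star_add star_scaleC
        sa ab scaleC_minus_left)
qed

text \<open>
  Positivity of \<open>\<omega> ((N + t A)\<^sup>* (N + t A)) = t \<omega> (N\<^sup>* A + A\<^sup>* N) + t\<^sup>2 \<omega> (A\<^sup>* A)\<close> for all small \<open>t\<close> of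
  either sign forces the linear term to vanish. Replacing \<open>A\<close> by \<open>\<i> A\<close> separates its two summands.
\<close>

lemma SPU_right_nullspace:
  assumes \<omega>: "SPU \<omega>" and N: "N \<in> right_nullspace \<omega>"
  shows "\<omega> (A * N) = 0"
proof -
  have lin: "clinear \<omega>" using \<omega> by (simp add: SPU_def)
  define X where "X A = \<omega> (star N * A + star A * N)" for A
  have pos: "norm_positive (X A)" for A
  proof (rule norm_positive_limit)
    show "star (X A) = X A"
      by (simp add: X_def SPU_star[OF \<omega>, symmetric] star_add star_mult star_star add.commute)
    fix t :: real assume "0 < t"
    have "star (N + t *\<^sub>R A) * (N + t *\<^sub>R A)
        = star N * N + t *\<^sub>R ((star N * A + star A * N) + t *\<^sub>R (star A * A))"
      by (simp add: star_add algebra_simps)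
    then have "\<omega> (star (N + t *\<^sub>R A) * (N + t *\<^sub>R A)) = t *\<^sub>R (X A + t *\<^sub>R \<omega> (star A * A))"
      using N by (simp add: X_def right_nullspace_def lin clinear_add clinear_scaleR)
    then have "X A + t *\<^sub>R \<omega> (star A * A)
        = (1 / t) *\<^sub>R \<omega> (star (N + t *\<^sub>R A) * (N + t *\<^sub>R A))"
      using \<open>0 < t\<close> by simp
    then show "norm_positive (X A + t *\<^sub>R \<omega> (star A * A))"
      using SPU_norm_positive[OF \<omega>] \<open>0 < t\<close> by (simp add: norm_positive_scaleR)
  qed
  have X0: "X A = 0" for A
  proof (rule norm_positive_antisym[OF pos])
    have "X (- A) = - X A"
      using clinear_diff[OF lin, of 0 "star N * A + star A * N"]
      by (simp add: X_def clinear_zero[OF lin])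
    then show "norm_positive (- X A)" using pos by metis
  qed
  define u v where "u = \<omega> (star N * star A)" and "v = \<omega> (A * N)"
  have "u + v = 0"
    using X0[of "star A"] by (simp add: X_def u_def v_def star_star lin clinear_add)
  moreover have "\<i> *\<^sub>C (u - v) = 0"
    using X0[of "\<i> *\<^sub>C star A"]
    by (simp add: X_def u_def v_def star_star star_scaleC mult_scaleC_left mult_scaleC_right
        lin clinear_add clinear_diff clinear_scaleC scaleC_minus_left scaleC_diff_right)
  then have "\<i> *\<^sub>C (\<i> *\<^sub>C (u - v)) = 0" by simp
  then have "u = v" by (simp add: scaleC_scaleC scaleC_minus_left)
  ultimately have "2 *\<^sub>R v = 0" by (simp add: scaleR_2)
  then show ?thesis by (simp add: v_def)
qed

text \<open>For one direction take \<open>A\<close> to be the adjoint of \<open>F B - G B\<close>;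
  the other is \<open>SPU_right_nullspace\<close>.\<close>

lemma right_ae_equivalent_iff_nullspace:
  assumes \<omega>: "SPU \<omega>"
  shows "right_ae_equivalent \<omega> F G \<longleftrightarrow> (\<forall>B. F B - G B \<in> right_nullspace \<omega>)"
proof -
  have lin: "clinear \<omega>" using \<omega> by (simp add: SPU_def)
  have "right_ae_equivalent \<omega> F G \<longleftrightarrow> (\<forall>A B. \<omega> (A * (F B - G B)) = 0)"
    by (simp add: right_ae_equivalent_def right_diff_distrib clinear_diff[OF lin])
  also have "\<dots> \<longleftrightarrow> (\<forall>B. F B - G B \<in> right_nullspace \<omega>)"
    using SPU_right_nullspace[OF \<omega>] by (auto simp: right_nullspace_def)
  finally show ?thesis .
qed

lemma left_ae_equivalent_iff_right:
  assumes "SPU \<omega>" "star_preserving F" "star_preserving G"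
  shows "left_ae_equivalent \<omega> F G \<longleftrightarrow> right_ae_equivalent \<omega> F G"
proof -
  have *: "\<omega> (H B * A) = star (\<omega> (star A * H (star B)))" if "star_preserving H" for H A B
    using that by (simp add: star_preserving_def star_mult star_star flip: SPU_star[OF assms(1)])
  have "left_ae_equivalent \<omega> F G
      \<longleftrightarrow> (\<forall>A B. \<omega> (star A * F (star B)) = \<omega> (star A * G (star B)))"
    unfolding left_ae_equivalent_def *[OF assms(2)] *[OF assms(3)] by (metis star_star)
  also have "\<dots> \<longleftrightarrow> right_ae_equivalent \<omega> F G"
    unfolding right_ae_equivalent_def by (metis star_star)
  finally show ?thesis .
qed

subsection \<open>Supports in finite dimension\<close>

text \<open>
  Since \<open>a\<close> is self-adjoint, \<open>a\<^sup>2 z = 0\<close> implies \<open>a z = 0\<close>, so left multiplication by \<open>a\<close> is injective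
  on the finite-dimensional space \<open>a \<A>\<close>, hence maps it onto itself.
\<close>

lemma finite_dim_self_adjoint_regular:
  fixes a :: "'a::unital_cstar_algebra"
  assumes fin: "finite_dim TYPE('a)" and a: "star a = a"
  shows "\<exists>q. a * (a * q) = a"
proof -
  let ?s = "scaleC :: complex \<Rightarrow> 'a \<Rightarrow> 'a"
  interpret V: vector_space ?s by (rule vector_space_scaleC)
  obtain S :: "'a set" where S: "finite S" "V.span S = UNIV"
    using fin by (auto simp: finite_dim_def)
  obtain B where B: "B \<subseteq> S" "V.independent B" "S \<subseteq> V.span B"
    by (rule V.maximal_independent_subset)
  have "V.span B = UNIV"
    using S(2) B(3) V.span_minimal[OF B(3)] by auto
  then interpret W: finite_dimensional_vector_space ?s B
    using B S(1) by unfold_locales (auto intro: finite_subset)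
  interpret P: finite_dimensional_vector_space_pair_1 ?s B ?s ..
  define f where "f z = a * z" for z
  define R where "R = range f"
  have f: "clinear f"
    by (simp add: f_def Vector_Spaces.linear_iff vector_space_scaleC distrib_left mult_scaleC_right)
  interpret f: Vector_Spaces.linear ?s ?s f by (rule f)
  have R: "V.subspace R" unfolding R_def by (rule f.subspace_image) simp
  have fR: "V.subspace (f ` R)" using R by (rule f.subspace_image)
  have "inj_on f R"
  proof (rule inj_onI)
    fix x y assume "x \<in> R" "y \<in> R" and xy: "f x = f y"
    then obtain z where z: "x - y = a * z"
      by (auto simp: R_def f_def simp flip: right_diff_distrib)
    have "star (a * z) * (a * z) = star z * (a * (x - y))"
      by (simp add: star_mult a z mult.assoc)
    also have "\<dots> = 0" using xy by (simp add: f_def right_diff_distrib)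
    finally show "x = y" using z by simp
  qed
  then have "V.dim (f ` R) = V.dim R"
    using P.dim_image_eq[OF f] R by (simp add: V.span_eq_iff[THEN iffD2])
  then have "f ` R = R"
    using W.subspace_dim_equal[OF fR R] by (auto simp: R_def)
  \<comment> \<open>As \<open>a = a * 1\<close> lies in the range, surjectivity on \<open>R\<close>
    yields \<open>q\<close>.\<close>
  moreover have "a \<in> R" unfolding R_def f_def by (rule range_eqI[of _ _ 1]) simp
  ultimately have "a \<in> f ` range f" by (simp add: R_def)
  then show ?thesis by (metis f_def imageE)
qed

text \<open>Each summand is the negative of the positive sum of the others, and the cone contains no
  line.\<close>

lemma sum_star_mult_self_eq_0:
  fixes f :: "'i \<Rightarrow> 'a::unital_cstar_algebra"
  assumes "finite I" "(\<Sum>i\<in>I. star (f i) * f i) = 0" "i \<in> I"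
  shows "f i = 0"
proof -
  have pos: "norm_positive (\<Sum>i\<in>J. star (f i) * f i)" if "finite J" for J
    using that
  proof (induction J)
    case empty
    show ?case using norm_positive_square[of 0] by simp
  qed (simp add: norm_positive_add norm_positive_star_mult_self)
  have "star (f i) * f i + (\<Sum>i\<in>I - {i}. star (f i) * f i) = 0"
    using sum.remove[OF assms(1,3), of "\<lambda>i. star (f i) * f i"] assms(2) by simp
  then have "- (star (f i) * f i) = (\<Sum>i\<in>I - {i}. star (f i) * f i)"
    by (rule minus_unique)
  then have "norm_positive (- (star (f i) * f i))" using pos assms(1) by simp
  then show ?thesis
    using norm_positive_antisym[OF norm_positive_star_mult_self[of "f i"]] by simp
qed

lemma finite_dim_left_ideal_projection:
  fixes L :: "'a::unital_cstar_algebra set"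
  assumes fin: "finite_dim TYPE('a)"
    and sub: "module.subspace scaleC L" and ideal: "\<And>x y. y \<in> L \<Longrightarrow> x * y \<in> L"
  obtains p where "projection p" "p \<in> L" "\<And>n. n \<in> L \<Longrightarrow> n * p = n"
proof -
  interpret V: vector_space "scaleC :: complex \<Rightarrow> 'a \<Rightarrow> 'a" by (rule vector_space_scaleC)
  obtain S :: "'a set" where S: "finite S" "V.span S = UNIV"
    using fin by (auto simp: finite_dim_def)
  obtain B where B: "B \<subseteq> L" "V.independent B" "L \<subseteq> V.span B"
    by (rule V.maximal_independent_subset)
  have "finite B"
    using V.independent_span_bound[OF S(1) B(2)] S(2) by simp
  define a where "a = (\<Sum>n\<in>B. star n * n)"
  have a: "star a = a"
    by (simp add: a_def star_sum star_mult star_star)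
  have "a \<in> L"
    unfolding a_def using B(1) ideal by (intro V.subspace_sum[OF sub]) auto
  obtain q where q: "a * (a * q) = a"
    using finite_dim_self_adjoint_regular[OF fin a] by blast
  \<comment> \<open>Taking adjoints in \<open>a * (a * q) = a\<close> gives
    \<open>p * a = a\<close>; also \<open>p * star p = star q * (a * (a * q)) = p\<close>, so
    \<open>p\<close> is self-adjoint and idempotent.\<close>
  define p where "p = star q * a"
  have "star (a * (a * q)) = a" by (simp add: q a)
  then have pa: "p * a = a"
    by (simp add: p_def star_mult a mult.assoc)
  have p_star: "star p = a * q" by (simp add: p_def star_mult a star_star)
  then have "p * star p = star q * (a * (a * q))" by (simp add: p_def mult.assoc)
  then have pp: "p * star p = p" by (simp add: q p_def)
  then have sp: "star p = p" by (metis star_mult star_star)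
  then have proj: "projection p" using pp by (simp add: projection_def)
  have "a * p = a" using pa by (metis a sp star_mult)
  \<comment> \<open>\<open>1 - p\<close> annihilates \<open>a\<close>, hence every generator,
    because no cancellation can occur in a sum of positive elements.\<close>
  have "(\<Sum>n\<in>B. star (n * (1 - p)) * (n * (1 - p))) = (1 - p) * a * (1 - p)"
    by (simp add: a_def sum_distrib_left sum_distrib_right star_mult star_diff sp mult.assoc)
  also have "\<dots> = 0" by (simp add: \<open>a * p = a\<close> right_diff_distrib mult.assoc)
  finally have "n * (1 - p) = 0" if "n \<in> B" for n
    using sum_star_mult_self_eq_0[OF \<open>finite B\<close>, of "\<lambda>n. n * (1 - p)"] that by blast
  then have basis: "n * p = n" if "n \<in> B" for n
    using that by (simp add: right_diff_distrib)
  have "V.subspace {n. n * p = n}"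
    by (auto simp: V.subspace_def distrib_right mult_scaleC_left)
  then have "V.span B \<subseteq> {n. n * p = n}"
    using basis by (intro V.span_minimal) auto
  then have "n * p = n" if "n \<in> L" for n
    using that B(3) by auto
  moreover have "p \<in> L" using ideal[OF \<open>a \<in> L\<close>] by (simp add: p_def)
  ultimately show ?thesis using proj that by blast
qed

lemma support_annihilator:
  fixes \<omega> :: "'a::unital_cstar_algebra \<Rightarrow> complex"
  assumes \<omega>: "SPU \<omega>" and fin: "finite_dim TYPE('a)"
  shows "A \<in> right_nullspace \<omega> \<longleftrightarrow> A * support \<omega> = 0"
proof -
  have lin: "clinear \<omega>" and one: "\<omega> 1 = 1" using \<omega> by (simp_all add: SPU_def)
  interpret V: vector_space "scaleC :: complex \<Rightarrow> 'a \<Rightarrow> 'a" by (rule vector_space_scaleC)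
  define L where "L = right_nullspace \<omega>"
  have L_iff: "N \<in> L \<longleftrightarrow> (\<forall>A. \<omega> (A * N) = 0)" for N
    using SPU_right_nullspace[OF \<omega>] by (auto simp: L_def right_nullspace_def)
  have "V.subspace L"
    by (auto simp: V.subspace_def L_iff distrib_left mult_scaleC_right clinear_zero[OF lin]
        clinear_add[OF lin] clinear_scaleC[OF lin])
  moreover have ideal: "x * y \<in> L" if "y \<in> L" for x y
    using that by (simp add: L_iff flip: mult.assoc)
  ultimately obtain p where p: "projection p" "p \<in> L" "\<And>n. n \<in> L \<Longrightarrow> n * p = n"
    using finite_dim_left_ideal_projection[OF fin] by metis
  have pp: "p * p = p" "star p = p" using p(1) by (simp_all add: projection_def)
  define P where "P = 1 - p"
  have P: "star P = P" "P * P = P" by (simp_all add: P_def star_diff pp algebra_simps)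
  have Ap: "\<omega> (A * p) = 0" for A using p(2) L_iff by blast
  have pA: "\<omega> (p * A) = 0" for A
    using Ap[of "star A"] SPU_star[OF \<omega>, of "star A * p"] by (simp add: star_mult star_star pp)
  have AP: "\<omega> (A * P) = \<omega> A" for A
    by (simp add: P_def right_diff_distrib clinear_diff[OF lin] Ap)
  have PA: "\<omega> (P * A) = \<omega> A" for A
    by (simp add: P_def left_diff_distrib clinear_diff[OF lin] pA)
  have sup: "supports \<omega> P"
    by (simp add: supports_def projection_def P AP PA)
  \<comment> \<open>From \<open>\<omega> R = 1\<close> the projection \<open>1 - R\<close> lies in
    \<open>L\<close>, so \<open>P\<close> annihilates it and \<open>R * P = P\<close>. Then
    \<open>R - P\<close> is itself a projection, hence positive.\<close>
  have le: "cstar_le P R" if R: "supports \<omega> R" for R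
  proof -
    have R': "star R = R" "R * R = R" "\<omega> R = 1"
      using R one by (auto simp: supports_def projection_def) (metis mult_1_left)
    have "star (1 - R) * (1 - R) = 1 - R"
      by (simp add: star_diff R' algebra_simps)
    then have "1 - R \<in> L"
      by (simp add: L_def right_nullspace_def clinear_diff[OF lin] R' one)
    then have "(1 - R) * p = 1 - R" by (rule p(3))
    then have RP: "R * P = P" by (simp add: P_def algebra_simps)
    then have PR: "P * R = P" by (metis P(1) R'(1) star_mult)
    have "R - P = star (R - P) * (R - P)"
      by (simp add: star_diff R' P algebra_simps RP PR)
    then show ?thesis unfolding cstar_le_def positive_element_def by blast
  qed
  have "support \<omega> = P"
    unfolding support_def using sup le by (intro the_equality) (auto intro: cstar_le_antisym)
  moreover have "A \<in> L \<longleftrightarrow> A * P = 0"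
  proof
    assume "A \<in> L"
    then show "A * P = 0" using p(3) by (simp add: P_def right_diff_distrib)
  next
    assume "A * P = 0"
    then have "A = A * p" by (simp add: P_def right_diff_distrib)
    then show "A \<in> L" using ideal[OF p(2), of A] by simp
  qed
  ultimately show ?thesis by (simp add: L_def)
qed

theorem theorem5p12:
  fixes F G :: "'b::unital_cstar_algebra \<Rightarrow> 'a::unital_cstar_algebra"
  assumes "clinear F" and "clinear G"
  shows
    "(\<forall>\<omega> :: 'a \<Rightarrow> 'c::unital_cstar_algebra. SPU \<omega> \<longrightarrow>
        (right_ae_equivalent \<omega> F G \<longleftrightarrow> (\<forall>B. F B - G B \<in> right_nullspace \<omega>)) \<and>
        (star_preserving F \<and> star_preserving G \<longrightarrow>
          (left_ae_equivalent \<omega> F G \<longleftrightarrow> right_ae_equivalent \<omega> F G) \<and>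
          (right_ae_equivalent \<omega> F G \<longleftrightarrow> (\<forall>B. F B - G B \<in> right_nullspace \<omega>)))) \<and>
     (\<forall>\<omega> :: 'a \<Rightarrow> complex. SPU \<omega> \<and> finite_dim TYPE('a) \<longrightarrow>
        (right_ae_equivalent \<omega> F G \<longleftrightarrow> (\<forall>B. F B - G B \<in> right_nullspace \<omega>)) \<and>
        ((\<forall>B. F B - G B \<in> right_nullspace \<omega>) \<longleftrightarrow> (\<forall>B. F B * support \<omega> = G B * support \<omega>)) \<and>
        (star_preserving F \<and> star_preserving G \<longrightarrow>
          (left_ae_equivalent \<omega> F G \<longleftrightarrow> right_ae_equivalent \<omega> F G) \<and>
          (right_ae_equivalent \<omega> F G \<longleftrightarrow> (\<forall>B. F B - G B \<in> right_nullspace \<omega>)) \<and>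
          ((\<forall>B. F B - G B \<in> right_nullspace \<omega>) \<longleftrightarrow> (\<forall>B. F B * support \<omega> = G B * support \<omega>))))"
  \<comment> \<open>For (d), \<open>support_annihilator\<close> is applied to
    \<open>F B - G B\<close>.\<close>
  by (simp add: right_ae_equivalent_iff_nullspace left_ae_equivalent_iff_right
      support_annihilator left_diff_distrib)

end
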